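(* Let $T$ be a finite tree and let $x,y\in V(T)$. The following are equivalent: (i) $D(x)\le D(y)$; (ii) $D_\pi(x)\le D_\pi(y)$; (iii) $H_{yx}\le H_{xy}$; (iv) $RC_\pi(x)\le RC_\pi(y)$; (v) $RC(x)\le RC(y)$; (vi) $CC(x)\ge CC(y)$.
   Context: For a finite connected graph, the simple random walk moves at each step to a uniformly random neighbour; $H_{vw}$ denotes the expected number of steps for the walk started at $v$ to first reach $w$ ($H_{vv}=0$). Let $d(w)$ denote the degree of $w$ and $d(v,w)$ the graph distance. Define $D(v)=\sum_{w\in V(T)} d(v,w)$, $D_\pi(v)=\sum_{w\in V(T)} d(w)\,d(v,w)$, $CC(v)=\sum_{w} H_{vw}$, $RC(v)=\sum_{w} H_{wv}$, and $RC_\pi(v)=\sum_{w} d(w)\,H_{wv}$. *)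

theory Defs
  imports "HOL-Probability.Probability" "Graph_Theory.Graph_Theory"
begin

text \<open>
  Graphs are the symmetric, finite, loop-free digraphs without parallel arcs of the locale
  \<^locale>\<open>graph\<close>. In this encoding every edge yields the closed walk \<open>a, b, a\<close>, which
  \<^const>\<open>pre_digraph.cycle\<close> accepts; hence the library constants \<open>forest\<close> and \<open>tree\<close> do not
  express acyclicity of the undirected graph, and cycles must be required to have at least
  three arcs. The degree of a vertex is its \<^const>\<open>out_degree\<close>.
\<close>

definition undirected_tree :: "('a, 'b) pre_digraph \<Rightarrow> bool" where
  "undirected_tree T \<longleftrightarrow>
     graph T \<and> Digraph_Component.connected T \<and> \<not> (\<exists>p. pre_digraph.cycle T p \<and> 3 \<le> length p)"

definition graph_dist :: "('a, 'b) pre_digraph \<Rightarrow> 'a \<Rightarrow> 'a \<Rightarrow> ereal" where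
  "graph_dist T v w = wf_digraph.\<mu> T (\<lambda>_. 1) v w"

definition neighbours :: "('a, 'b) pre_digraph \<Rightarrow> 'a \<Rightarrow> 'a set" where
  "neighbours T v = {u. v \<rightarrow>\<^bsub>T\<^esub> u}"

text \<open>
  The conditional law of the \<open>i\<close>-th position given the trajectory \<open>\<omega>\<close> before time \<open>i\<close>.
  At an isolated vertex \<^const>\<open>pmf_of_set\<close> is unspecified; in a connected graph this only
  concerns the one-vertex graph, where no step is ever needed.
\<close>

definition srw_kernel :: "('a, 'b) pre_digraph \<Rightarrow> 'a \<Rightarrow> nat \<Rightarrow> (nat \<Rightarrow> 'a) \<Rightarrow> 'a measure" where
  "srw_kernel T v i \<omega> =
     measure_pmf (if i = 0 then return_pmf v else pmf_of_set (neighbours T (\<omega> (i - 1))))"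

lemma Ionescu_Tulcea_srw_kernel:
  fixes T :: "('a, 'b) pre_digraph" and v :: 'a
  shows "Ionescu_Tulcea (srw_kernel T v) (\<lambda>_. count_space UNIV)"
proof (rule Ionescu_Tulcea.intro)
  fix i
  show "srw_kernel T v i \<in> PiM {0..<i} (\<lambda>_. count_space UNIV) \<rightarrow>\<^sub>M subprob_algebra (count_space UNIV)"
  proof (cases "i = 0")
    case True
    then show ?thesis
      unfolding srw_kernel_def by (simp add: measure_pmf_in_subprob_algebra)
  next
    case False
    then have "i - 1 \<in> {0..<i}" by simp
    then have "(\<lambda>\<omega>. \<omega> (i - 1)) \<in> PiM {0..<i} (\<lambda>_. count_space UNIV) \<rightarrow>\<^sub>M count_space UNIV"
      by (rule measurable_component_singleton)
    moreover have "(\<lambda>u. measure_pmf (pmf_of_set (neighbours T u)))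
        \<in> count_space UNIV \<rightarrow>\<^sub>M subprob_algebra (count_space UNIV)"
      by (simp add: measure_pmf_in_subprob_algebra)
    ultimately show ?thesis
      using False unfolding srw_kernel_def by simp
  qed
next
  fix i :: nat and \<omega> :: "nat \<Rightarrow> 'a"
  assume "\<omega> \<in> space (PiM {0..<i} (\<lambda>_. count_space UNIV))"
  show "prob_space (srw_kernel T v i \<omega>)"
    unfolding srw_kernel_def by (rule measure_pmf.prob_space_axioms)
qed

text \<open>
  The law of the whole trajectory started at \<open>v\<close>: the Ionescu-Tulcea measure of the kernels.
\<close>

definition random_walk :: "('a, 'b) pre_digraph \<Rightarrow> 'a \<Rightarrow> (nat \<Rightarrow> 'a) measure" where
  "random_walk T v =
     projective_family.lim UNIV
       (Ionescu_Tulcea.CI (srw_kernel T v) (\<lambda>_. count_space UNIV)) (\<lambda>_. count_space UNIV)"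

text \<open>The infimum is \<open>\<infinity>\<close> for trajectories that never visit \<open>w\<close>.\<close>

definition hitting_time :: "'a \<Rightarrow> (nat \<Rightarrow> 'a) \<Rightarrow> ennreal" where
  "hitting_time w \<omega> = (INF n\<in>{n. \<omega> n = w}. of_nat n)"

definition H :: "('a, 'b) pre_digraph \<Rightarrow> 'a \<Rightarrow> 'a \<Rightarrow> ennreal" where
  "H T v w = (\<integral>\<^sup>+ \<omega>. hitting_time w \<omega> \<partial>random_walk T v)"

definition D :: "('a, 'b) pre_digraph \<Rightarrow> 'a \<Rightarrow> ereal" where
  "D T v = (\<Sum>w\<in>verts T. graph_dist T v w)"

definition D_pi :: "('a, 'b) pre_digraph \<Rightarrow> 'a \<Rightarrow> ereal" where
  "D_pi T v = (\<Sum>w\<in>verts T. ereal (real (out_degree T w)) * graph_dist T v w)"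

definition CC :: "('a, 'b) pre_digraph \<Rightarrow> 'a \<Rightarrow> ennreal" where
  "CC T v = (\<Sum>w\<in>verts T. H T v w)"

definition RC :: "('a, 'b) pre_digraph \<Rightarrow> 'a \<Rightarrow> ennreal" where
  "RC T v = (\<Sum>w\<in>verts T. H T w v)"

definition RC_pi :: "('a, 'b) pre_digraph \<Rightarrow> 'a \<Rightarrow> ennreal" where
  "RC_pi T v = (\<Sum>w\<in>verts T. of_nat (out_degree T w) * H T w v)"

end

theory Submission
  imports Defs
begin

text \<open>
  In a tree exactly one neighbour of \<open>x \<noteq> z\<close> is closer to \<open>z\<close> and all others are farther away, so
  the graph Laplacian of \<open>d(\<cdot>, z)\<close> at \<open>x\<close> is \<open>deg x - 2\<close> for \<open>x \<noteq> z\<close> and \<open>deg x\<close> for \<open>x = z\<close>.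
  Summing this identity, and the analogous one for squared distances, over all arcs gives
  \<open>\<Sum> deg = 2 m\<close> and \<open>D\<^sub>\<pi> = 2 D - m\<close> with \<open>m = n - 1\<close>. It also shows that
  \<open>m d(x, y) + D(y) - D(x)\<close> satisfies the first-step equations of the expected hitting times, and
  an optional-stopping argument identifies it with \<open>H\<^bsub>xy\<^esub>\<close>. Hence
  \<open>H\<^bsub>xy\<^esub> - H\<^bsub>yx\<^esub> = 2 (D(y) - D(x))\<close>, while \<open>D\<^sub>\<pi>\<close>, \<open>RC\<close>, \<open>RC\<^sub>\<pi>\<close> and \<open>CC\<close> are affine in \<open>D\<close> with slopes
  \<open>2\<close>, \<open>m + n\<close>, \<open>4 m\<close> and \<open>-1\<close>.
\<close>

section \<open>Expected hitting times from the first-step equations\<close>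

text \<open>The pathwise tail-sum formula: \<open>k\<close> is counted exactly when \<open>w\<close>
  is still unseen at time \<open>k\<close>. If \<open>w\<close> is never visited, every term is 1
  and both sides are infinite.\<close>

lemma hitting_time_eq_suminf:
  "hitting_time w \<omega> = (\<Sum>k. indicator {\<omega>. \<forall>i\<le>k. \<omega> i \<noteq> w} \<omega>)"
proof (cases "\<exists>n. \<omega> n = w")
  case True
  define n where "n = (LEAST n. \<omega> n = w)"
  have n: "\<omega> n = w" unfolding n_def using True by (rule LeastI_ex)
  have le: "n \<le> k" if "\<omega> k = w" for k unfolding n_def using that by (rule Least_le)
  have "hitting_time w \<omega> = of_nat n"
    unfolding hitting_time_def
    by (intro antisym INF_lower INF_greatest) (auto simp: n le)
  moreover have ind: "indicator {\<omega>. \<forall>i\<le>k. \<omega> i \<noteq> w} \<omega> = (if k \<in> {..<n} then 1 else 0 :: ennreal)" for k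
  proof -
    have "(\<forall>i\<le>k. \<omega> i \<noteq> w) \<longleftrightarrow> k < n" using n le by (metis le_trans not_le)
    then show ?thesis by (simp add: indicator_def)
  qed
  have "(\<Sum>k. indicator {\<omega>. \<forall>i\<le>k. \<omega> i \<noteq> w} \<omega> :: ennreal) = (\<Sum>k<n. 1)"
    unfolding ind by (subst suminf_finite[of "{..<n}"]) auto
  ultimately show ?thesis by simp
next
  case False
  then have "hitting_time w \<omega> = top"
    by (auto simp: hitting_time_def)
  moreover have "(\<Sum>k. 1 :: ennreal) = top"
  proof (rule ccontr)
    assume *: "(\<Sum>k. 1 :: ennreal) \<noteq> top"
    have "of_nat n \<le> (\<Sum>k. 1 :: ennreal)" for n
      using sum_le_suminf[of "\<lambda>_. 1 :: ennreal" "{..<n}"] by simp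
    with * show False
      using ennreal_Ex_less_of_nat[of "\<Sum>k. 1"] by (auto simp: less_top not_less[symmetric])
  qed
  ultimately show ?thesis using False by (simp add: indicator_def)
qed

lemma pred_coordinates_in:
  fixes k :: nat
  assumes "{..k} \<subseteq> J"
  shows "Measurable.pred (PiM J (\<lambda>_. count_space UNIV)) (\<lambda>\<omega>. \<forall>i\<le>k. \<omega> i \<in> S)"
proof -
  have "Measurable.pred (PiM J (\<lambda>_. count_space UNIV)) (\<lambda>\<omega>. \<omega> i \<in> S)" if "i \<in> {..k}" for i
    using that assms by (intro measurable_compose[OF measurable_component_singleton]) auto
  then have "Measurable.pred (PiM J (\<lambda>_. count_space UNIV)) (\<lambda>\<omega>. \<forall>i\<in>{..k}. \<omega> i \<in> S)"
    by (intro pred_intros_finite) auto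
  then show ?thesis by (simp only: Ball_def atMost_iff)
qed

section \<open>The law of the trajectory and its Markov property\<close>

lemma sets_random_walk:
  "sets (random_walk T v) = sets (PiM UNIV (\<lambda>_. count_space UNIV))"
proof -
  interpret Ionescu_Tulcea "srw_kernel T v" "\<lambda>_. count_space UNIV"
    by (rule Ionescu_Tulcea_srw_kernel)
  show ?thesis unfolding random_walk_def by simp
qed

lemma borel_measurable_random_walk_coordinate:
  fixes g :: "'a \<Rightarrow> ennreal"
  shows "(\<lambda>\<omega>. g (\<omega> i)) \<in> borel_measurable (random_walk T v)"
  unfolding measurable_cong_sets[OF sets_random_walk refl]
  by (rule measurable_compose[OF measurable_component_singleton]) auto

lemma prob_space_random_walk: "prob_space (random_walk T v)"
proof -
  interpret Ionescu_Tulcea "srw_kernel T v" "\<lambda>_. count_space UNIV"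
    by (rule Ionescu_Tulcea_srw_kernel)
  \<comment> \<open>Projecting to the empty index set preserves total mass, and every finite
    marginal is a probability measure.\<close>
  have "prob_space (distr PF.lim (PiM {} (\<lambda>_. count_space UNIV)) (\<lambda>x. restrict x {}))"
    by (subst distr_lim) (auto intro: PF.prob_space_P)
  then show ?thesis
    unfolding random_walk_def by (rule prob_space_distrD[rotated]) (auto simp: measurable_cong_sets[OF PF.sets_lim refl])
qed

text \<open>Given the positions before time \<open>n\<close>, position \<open>n\<close> is
  integrated out against its kernel. This rests on \<open>C 0 (Suc n)\<close> being built from
  \<open>C 0 n\<close> by appending one coordinate.\<close>

lemma nn_integral_random_walk_Suc:
  assumes [measurable]: "f \<in> borel_measurable (PiM {0..<Suc n} (\<lambda>_. count_space UNIV))"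
  shows "(\<integral>\<^sup>+ \<omega>. f (restrict \<omega> {0..<Suc n}) \<partial>random_walk T v)
       = (\<integral>\<^sup>+ \<omega>. (\<integral>\<^sup>+ z. f ((restrict \<omega> {0..<n})(n := z)) \<partial>srw_kernel T v n (restrict \<omega> {0..<n})) \<partial>random_walk T v)"
proof -
  interpret Ionescu_Tulcea "srw_kernel T v" "\<lambda>_. count_space UNIV"
    by (rule Ionescu_Tulcea_srw_kernel)
  let ?M = "\<lambda>k. PiM {0..<k} (\<lambda>_. count_space (UNIV::'a set))"
  let ?C = "\<lambda>k. C 0 k (\<lambda>_. undefined)"
  have u: "(\<lambda>_. undefined) \<in> space (?M 0)" by (auto simp: space_PiM PiE_iff extensional_def)
  have fin: "(\<integral>\<^sup>+ \<omega>. g (restrict \<omega> {0..<k}) \<partial>random_walk T v) = (\<integral>\<^sup>+ \<omega>. g \<omega> \<partial>?C k)"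
    if [measurable]: "g \<in> borel_measurable (?M k)" for g k
  proof -
    \<comment> \<open>\<open>CI\<close> is defined through the first \<open>up_to J\<close>
      coordinates; for an initial segment these are the segment itself, so the marginal is
      \<open>C 0 k\<close>.\<close>
    have ut: "up_to {0..<k} = k"
      unfolding up_to_def by (rule Least_equality) (auto simp: not_le[symmetric])
    have "(\<integral>\<^sup>+ \<omega>. g (restrict \<omega> {0..<k}) \<partial>PF.lim)
        = (\<integral>\<^sup>+ \<omega>. g \<omega> \<partial>distr PF.lim (?M k) (\<lambda>x. restrict x {0..<k}))"
      by (subst nn_integral_distr) (auto simp: measurable_cong_sets[OF PF.sets_lim refl])
    also have "\<dots> = (\<integral>\<^sup>+ \<omega>. g \<omega> \<partial>CI {0..<k})" by (simp add: distr_lim)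
    also have "\<dots> = (\<integral>\<^sup>+ \<omega>. g (restrict \<omega> {0..<k}) \<partial>?C k)"
      unfolding CI_def ut using sets_C[OF u, of k]
      by (subst nn_integral_distr) (auto simp: measurable_cong_sets[OF sets_C[OF u] refl])
    also have "\<dots> = (\<integral>\<^sup>+ \<omega>. g \<omega> \<partial>?C k)"
      using space_C[OF u, of k] by (intro nn_integral_cong) (auto simp: space_PiM)
    finally show ?thesis unfolding random_walk_def .
  qed
  have [measurable]: "(\<lambda>\<omega>. \<integral>\<^sup>+ x. f x \<partial>eP n \<omega>) \<in> borel_measurable (?M n)"
    by (rule measurable_compose[OF measurable_eP nn_integral_measurable_subprob_algebra]) measurable
  have "(\<integral>\<^sup>+ \<omega>. f (restrict \<omega> {0..<Suc n}) \<partial>random_walk T v) = (\<integral>\<^sup>+ \<omega>. f \<omega> \<partial>?C (Suc n))"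
    by (rule fin) measurable
  also have "\<dots> = (\<integral>\<^sup>+ \<omega>. (\<integral>\<^sup>+ x. f x \<partial>eP n \<omega>) \<partial>?C n)"
    by (simp, rule nn_integral_bind[where B="?M (Suc n)"]) (auto simp: measurable_cong_sets[OF sets_C[OF u] refl])
  also have "\<dots> = (\<integral>\<^sup>+ \<omega>. (\<integral>\<^sup>+ x. f x \<partial>eP n (restrict \<omega> {0..<n})) \<partial>random_walk T v)"
    by (rule fin[symmetric]) measurable
  also have "\<dots> = (\<integral>\<^sup>+ \<omega>. (\<integral>\<^sup>+ z. f ((restrict \<omega> {0..<n})(n := z)) \<partial>srw_kernel T v n (restrict \<omega> {0..<n})) \<partial>random_walk T v)"
    by (intro nn_integral_cong nn_integral_eP) (auto simp: space_PiM)
  finally show ?thesis .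
qed

lemma AE_random_walk_0: "AE \<omega> in random_walk T v. \<omega> 0 = v"
proof -
  interpret prob_space "random_walk T v" by (rule prob_space_random_walk)
  have m: "(\<lambda>\<omega>. indicator (-{v}) (\<omega> 0) :: ennreal) \<in> borel_measurable (PiM {0..<Suc 0} (\<lambda>_. count_space UNIV))"
    by (rule measurable_compose[OF measurable_component_singleton]) auto
  have "(\<integral>\<^sup>+ \<omega>. indicator (-{v}) (\<omega> 0) \<partial>random_walk T v) = (0 :: ennreal)"
    using nn_integral_random_walk_Suc[OF m, of T v]
    by (simp add: srw_kernel_def)
  then have "AE \<omega> in random_walk T v. indicator (-{v}) (\<omega> 0) = (0::ennreal)"
    by (subst (asm) nn_integral_0_iff_AE) (rule borel_measurable_random_walk_coordinate)
  then show ?thesis by eventually_elim (auto simp: indicator_def split: if_splits)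
qed

text \<open>The Markov property on the event of staying in \<open>S\<close> up to time
  \<open>n\<close>. That event depends only on coordinates up to \<open>n\<close>, so its indicator
  factors out of the integral over the next position.\<close>

lemma nn_integral_random_walk_step:
  fixes g :: "'a \<Rightarrow> ennreal"
  shows "(\<integral>\<^sup>+ \<omega>. g (\<omega> (Suc n)) * indicator {\<omega>. \<forall>i\<le>n. \<omega> i \<in> S} \<omega> \<partial>random_walk T v)
       = (\<integral>\<^sup>+ \<omega>. (\<integral>\<^sup>+ z. g z \<partial>pmf_of_set (neighbours T (\<omega> n))) * indicator {\<omega>. \<forall>i\<le>n. \<omega> i \<in> S} \<omega> \<partial>random_walk T v)"
proof -
  let ?f = "\<lambda>\<omega>. g (\<omega> (Suc n)) * indicator {\<omega>. \<forall>i\<le>n. \<omega> i \<in> S} \<omega>"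
  have ind: "indicator {\<omega>. \<forall>i\<le>n. \<omega> i \<in> S} \<omega> = (if \<forall>i\<le>n. \<omega> i \<in> S then 1 else 0 :: ennreal)" for \<omega>
    by (simp add: indicator_def)
  have m: "?f \<in> borel_measurable (PiM {0..<Suc (Suc n)} (\<lambda>_. count_space UNIV))"
  proof -
    have g: "(\<lambda>\<omega>. g (\<omega> (Suc n))) \<in> borel_measurable (PiM {0..<Suc (Suc n)} (\<lambda>_. count_space UNIV))"
      by (rule measurable_compose[OF measurable_component_singleton]) auto
    have p: "Measurable.pred (PiM {0..<Suc (Suc n)} (\<lambda>_. count_space UNIV)) (\<lambda>\<omega>. \<forall>i\<le>n. \<omega> i \<in> S)"
      by (rule pred_coordinates_in) auto
    have "(\<lambda>\<omega>. if \<forall>i\<le>n. \<omega> i \<in> S then 1 else 0 :: ennreal)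
        \<in> borel_measurable (PiM {0..<Suc (Suc n)} (\<lambda>_. count_space UNIV))"
      by (rule measurable_If[OF _ _ p[unfolded pred_def]]) simp_all
    with g show ?thesis
      unfolding ind by (rule borel_measurable_times_ennreal)
  qed
  have "?f (restrict \<omega> {0..<Suc (Suc n)}) = ?f \<omega>" for \<omega>
    by (auto simp: indicator_def)
  moreover have "?f ((restrict \<omega> {0..<Suc n})(Suc n := z)) = g z * indicator {\<omega>. \<forall>i\<le>n. \<omega> i \<in> S} \<omega>" for \<omega> z
    by (auto simp: indicator_def)
  moreover have "srw_kernel T v (Suc n) (restrict \<omega> {0..<Suc n}) = measure_pmf (pmf_of_set (neighbours T (\<omega> n)))" for \<omega>
    by (simp add: srw_kernel_def)
  ultimately show ?thesis
    using nn_integral_random_walk_Suc[OF m, of T v] by (simp only:) (simp add: nn_integral_multc)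
qed

text \<open>Optional stopping by hand. Recurrence comes out of the argument, since
  \<open>h v\<close> bounds the expected time spent before \<open>w\<close>. Finiteness of
  \<open>V\<close> bounds \<open>h\<close>, so no remainder survives in the limit.\<close>

lemma hitting_time_expectation:
  fixes h :: "'a \<Rightarrow> real"
  assumes V: "finite V" "v \<in> V"
    and nb: "\<And>u. u \<in> V \<Longrightarrow> u \<noteq> w \<Longrightarrow> neighbours T u \<subseteq> V \<and> neighbours T u \<noteq> {}"
    and h0: "h w = 0" and nonneg: "\<And>u. u \<in> V \<Longrightarrow> 0 \<le> h u"
    and step: "\<And>u. u \<in> V \<Longrightarrow> u \<noteq> w \<Longrightarrow> h u = 1 + (\<Sum>z\<in>neighbours T u. h z) / card (neighbours T u)"
  shows "H T v w = ennreal (h v)"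
proof -
  interpret prob_space "random_walk T v" by (rule prob_space_random_walk)
  let ?M = "random_walk T v"
  \<comment> \<open>The survival events. Staying in \<open>V\<close> is built in so that the
    first-step equation is available at position \<open>k\<close>.\<close>
  define A where "A k = {\<omega>. \<forall>i\<le>k. \<omega> i \<in> V - {w}}" for k :: nat
  have mA: "A k \<in> sets ?M" for k
  proof -
    have "Measurable.pred ?M (\<lambda>\<omega>. \<forall>i\<le>k. \<omega> i \<in> V - {w})"
      unfolding measurable_cong_sets[OF sets_random_walk refl] by (rule pred_coordinates_in) simp
    moreover have "space ?M = UNIV"
      using sets_eq_imp_space_eq[OF sets_random_walk[of T v]] by (simp add: space_PiM)
    ultimately show ?thesis by (simp add: A_def pred_def)
  qed
  have mi: "(\<lambda>\<omega>. g (\<omega> k) * indicator (A j) \<omega>) \<in> borel_measurable ?M" for g :: "'a \<Rightarrow> ennreal" and k j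
    by (intro borel_measurable_times_ennreal borel_measurable_random_walk_coordinate
        borel_measurable_indicator mA)
  txt \<open>Since \<open>h\<close> drops by one in mean at each step before \<open>w\<close> is hit, \<open>a (k + 1) + p k = a k\<close>;
    telescoping bounds the sum of the \<open>p k\<close>, whence \<open>p\<close> and then \<open>a\<close> tend to 0.\<close>
  define a where "a k = (\<integral>\<^sup>+ \<omega>. ennreal (h (\<omega> k)) * indicator (A k) \<omega> \<partial>?M)" for k
  define p where "p k = emeasure ?M (A k)" for k
  \<comment> \<open>The trajectory space contains every sequence, also those that ignore the edges,
    so this can only hold almost surely.\<close>
  have stay: "AE \<omega> in ?M. \<omega> \<in> A k \<longrightarrow> \<omega> (Suc k) \<in> V" for k
  proof -
    have "(\<integral>\<^sup>+ \<omega>. indicator (-V) (\<omega> (Suc k)) * indicator (A k) \<omega> \<partial>?M) = 0"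
      unfolding A_def nn_integral_random_walk_step
    proof (intro nn_integral_zero' AE_I2)
      fix \<omega> :: "nat \<Rightarrow> 'a"
      show "(\<integral>\<^sup>+ z. indicator (- V) z \<partial>measure_pmf (pmf_of_set (neighbours T (\<omega> k))))
          * indicator {\<omega>. \<forall>i\<le>k. \<omega> i \<in> V - {w}} \<omega> = (0 :: ennreal)"
      proof (cases "\<omega> k \<in> V - {w}")
        case True
        with nb[of "\<omega> k"] V have "neighbours T (\<omega> k) \<subseteq> V" "neighbours T (\<omega> k) \<noteq> {}" "finite (neighbours T (\<omega> k))"
          by (auto intro: finite_subset)
        then show ?thesis by (auto simp: emeasure_pmf_of_set Int_absorb2 disjoint_eq_subset_Compl)
      qed (auto simp: indicator_def)
    qed
    then have "AE \<omega> in ?M. indicator (-V) (\<omega> (Suc k)) * indicator (A k) \<omega> = (0::ennreal)"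
      by (subst (asm) nn_integral_0_iff_AE) (rule mi)
    then show ?thesis by eventually_elim (auto simp: indicator_def split: if_splits)
  qed
  have inV: "AE \<omega> in ?M. \<forall>k. \<omega> \<in> A k \<longrightarrow> \<omega> (Suc k) \<in> V"
    using stay by (simp add: AE_all_countable)
  have a_step: "a (Suc k) + p k = a k" for k
  proof -
    have "a (Suc k) = (\<integral>\<^sup>+ \<omega>. ennreal (h (\<omega> (Suc k))) * indicator (A k) \<omega> \<partial>?M)"
      unfolding a_def
    proof (intro nn_integral_cong_AE)
      \<comment> \<open>Almost surely, \<open>A k\<close> and \<open>A (Suc k)\<close> differ only
        by arrival at \<open>w\<close>, where \<open>h\<close> vanishes.\<close>
      show "AE \<omega> in ?M. ennreal (h (\<omega> (Suc k))) * indicator (A (Suc k)) \<omega> = ennreal (h (\<omega> (Suc k))) * indicator (A k) \<omega>"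
        using inV
      proof eventually_elim
        case (elim \<omega>)
        then show ?case
          by (cases "\<omega> (Suc k) = w") (auto simp: A_def indicator_def h0 le_Suc_eq)
      qed
    qed
    also have "\<dots> = (\<integral>\<^sup>+ \<omega>. (\<integral>\<^sup>+ z. ennreal (h z) \<partial>pmf_of_set (neighbours T (\<omega> k))) * indicator (A k) \<omega> \<partial>?M)"
      unfolding A_def by (rule nn_integral_random_walk_step)
    finally have "a (Suc k) + p k = (\<integral>\<^sup>+ \<omega>. (\<integral>\<^sup>+ z. ennreal (h z) \<partial>pmf_of_set (neighbours T (\<omega> k))) * indicator (A k) \<omega> + indicator (A k) \<omega> \<partial>?M)"
      using mi[of "\<lambda>x. \<integral>\<^sup>+ z. ennreal (h z) \<partial>pmf_of_set (neighbours T x)" k k]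
      unfolding p_def by (subst nn_integral_add) (simp_all add: mA borel_measurable_indicator)
    also have "\<dots> = a k"
      unfolding a_def
    proof (intro nn_integral_cong)
      fix \<omega>
      show "(\<integral>\<^sup>+ z. ennreal (h z) \<partial>pmf_of_set (neighbours T (\<omega> k))) * indicator (A k) \<omega> + indicator (A k) \<omega> = ennreal (h (\<omega> k)) * indicator (A k) \<omega>"
      proof (cases "\<omega> \<in> A k")
        case True
        then have u: "\<omega> k \<in> V" "\<omega> k \<noteq> w" by (auto simp: A_def)
        let ?N = "neighbours T (\<omega> k)"
        have N: "?N \<subseteq> V" "?N \<noteq> {}" using nb[OF u] by auto
        have fN: "finite ?N" using N(1) V(1) by (rule finite_subset)
        have pos: "0 \<le> h z" if "z \<in> ?N" for z using that N nonneg by auto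
        have "(\<integral>\<^sup>+ z. ennreal (h z) \<partial>pmf_of_set ?N) = ennreal (\<Sum>z\<in>?N. h z) / card ?N"
          using N fN pos by (simp add: nn_integral_pmf_of_set sum_ennreal)
        also have "\<dots> = ennreal ((\<Sum>z\<in>?N. h z) / card ?N)"
          using N fN pos by (simp add: ennreal_of_nat_eq_real_of_nat divide_ennreal sum_nonneg card_gt_0_iff)
        finally have "(\<integral>\<^sup>+ z. ennreal (h z) \<partial>pmf_of_set ?N) + 1 = ennreal (h (\<omega> k))"
          using step[OF u] ennreal_plus[of "(\<Sum>z\<in>?N. h z) / card ?N" 1] pos
          by (simp add: sum_nonneg add.commute)
        then show ?thesis using True by simp
      qed simp
    qed
    finally show ?thesis .
  qed
  have a0: "a 0 = h v"
  proof -
    have "a 0 = (\<integral>\<^sup>+ \<omega>. ennreal (h v) \<partial>?M)"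
      unfolding a_def
    proof (intro nn_integral_cong_AE)
      \<comment> \<open>For \<open>v = w\<close> both sides are 0.\<close>
      show "AE \<omega> in ?M. ennreal (h (\<omega> 0)) * indicator (A 0) \<omega> = ennreal (h v)"
        using AE_random_walk_0[of v T]
        by eventually_elim (use V h0 in \<open>auto simp: A_def indicator_def\<close>)
    qed
    then show ?thesis by (simp add: emeasure_space_1)
  qed
  have tele: "(\<Sum>k<n. p k) + a n = h v" for n
  proof (induction n)
    case (Suc n)
    have "(\<Sum>k<Suc n. p k) + a (Suc n) = (\<Sum>k<n. p k) + (a (Suc n) + p n)"
      by (simp add: ac_simps)
    then show ?case using a_step[of n] Suc by simp
  qed (simp add: a0)
  have sum_le: "(\<Sum>k. p k) \<le> h v"
  proof (intro suminf_le_const)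
    show "(\<Sum>k<n. p k) \<le> ennreal (h v)" for n
      using tele[of n] by (metis le_iff_add)
  qed simp
  \<comment> \<open>The sum of all values is a crude bound for each of them; only boundedness
    matters.\<close>
  obtain B where B: "\<And>u. u \<in> V \<Longrightarrow> h u \<le> B" "0 \<le> B"
    using that[of "\<Sum>u\<in>V. h u"] V nonneg by (auto intro: member_le_sum sum_nonneg)
  have a_le: "a n \<le> B * p n" for n
  proof -
    have "a n \<le> (\<integral>\<^sup>+ \<omega>. ennreal B * indicator (A n) \<omega> \<partial>?M)"
      unfolding a_def by (intro nn_integral_mono) (auto simp: A_def indicator_def intro!: ennreal_leI B)
    then show ?thesis by (simp add: nn_integral_cmult_indicator p_def mA)
  qed
  have "(\<lambda>n. p n) \<longlonglongrightarrow> 0"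
  proof -
    have "summable (\<lambda>n. measure ?M (A n))"
    proof (rule summable_suminf_not_top)
      have "(\<Sum>k. ennreal (measure ?M (A k))) \<le> h v"
        using sum_le by (simp add: p_def emeasure_eq_measure)
      then show "(\<Sum>k. ennreal (measure ?M (A k))) \<noteq> top"
        by (auto simp: top_unique)
    qed simp
    then have "(\<lambda>n. measure ?M (A n)) \<longlonglongrightarrow> 0" by (rule summable_LIMSEQ_zero)
    then have "(\<lambda>n. ennreal (measure ?M (A n))) \<longlonglongrightarrow> ennreal 0" by (rule tendsto_ennrealI)
    then show ?thesis by (simp add: p_def emeasure_eq_measure)
  qed
  then have "(\<lambda>n. ennreal B * p n) \<longlonglongrightarrow> ennreal B * 0"
    by (intro ennreal_tendsto_cmult) auto
  then have "a \<longlonglongrightarrow> 0"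
    by (intro tendsto_sandwich[where f = "\<lambda>_. 0" and g = a and h = "\<lambda>n. ennreal B * p n"]) (auto simp: a_le)
  moreover have "(\<lambda>n. \<Sum>k<n. p k) \<longlonglongrightarrow> (\<Sum>k. p k)"
    by (intro summable_LIMSEQ) auto
  ultimately have "(\<lambda>n. (\<Sum>k<n. p k) + a n) \<longlonglongrightarrow> (\<Sum>k. p k) + 0"
    by (intro tendsto_add)
  then have sum_p: "(\<Sum>k. p k) = h v"
    unfolding tele by (simp add: LIMSEQ_const_iff)
  have "H T v w = (\<integral>\<^sup>+ \<omega>. (\<Sum>k. indicator (A k) \<omega>) \<partial>?M)"
    unfolding H_def
  proof (intro nn_integral_cong_AE)
    show "AE \<omega> in ?M. hitting_time w \<omega> = (\<Sum>k. indicator (A k) \<omega>)"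
      using inV AE_random_walk_0[of v T]
    proof eventually_elim
      case (elim \<omega>)
      \<comment> \<open>Membership in \<open>V\<close> propagates along the trajectory, so avoiding
        \<open>w\<close> up to time \<open>k\<close> already means lying in
        \<open>A k\<close>.\<close>
      have "\<omega> \<in> A k" if "\<forall>i\<le>k. \<omega> i \<noteq> w" for k
        using that
      proof (induction k)
        case 0
        then show ?case using elim V by (auto simp: A_def)
      next
        case (Suc k)
        then have "\<omega> \<in> A k" by auto
        with elim Suc.prems show ?case by (auto simp: A_def le_Suc_eq)
      qed
      then have "(\<forall>i\<le>k. \<omega> i \<noteq> w) \<longleftrightarrow> \<omega> \<in> A k" for k by (auto simp: A_def)
      then show ?case
        unfolding hitting_time_eq_suminf by (simp add: indicator_def)
    qed
  qed
  also have "\<dots> = (\<Sum>k. p k)"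
    by (subst nn_integral_suminf) (simp_all add: p_def[abs_def] mA borel_measurable_indicator)
  finally show ?thesis using sum_p by simp
qed

section \<open>Distances in trees\<close>

locale acyclic_connected_graph = graph G for G :: "('a, 'b) pre_digraph" (structure) +
  assumes conn: "Digraph_Component.connected G"
    and acyclic: "\<And>p. cycle p \<Longrightarrow> length p < 3"
begin

section \<open>Neighbourhoods, degrees and the hop distance\<close>

abbreviation "V \<equiv> verts G"
abbreviation "N \<equiv> neighbours G"

text \<open>A natural-number counterpart of the \<open>ereal\<close>-valued
  \<open>graph_dist\<close>, which keeps the arithmetic in \<open>nat\<close> and
  \<open>real\<close>.\<close>

definition hops :: "'a \<Rightarrow> 'a \<Rightarrow> nat" where
  "hops u v = (LEAST n. \<exists>p. awalk u p v \<and> length p = n)"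

lemma finite_V: "finite V" by simp

lemma neighbours_sym: "u \<in> N x \<longleftrightarrow> x \<in> N u"
  unfolding neighbours_def using sym_arcs by (auto simp: symmetric_def elim: symE)

lemma neighbours_subset: "N x \<subseteq> V"
  by (auto simp: neighbours_def)

lemma finite_neighbours: "finite (N x)"
  using neighbours_subset finite_V by (rule finite_subset)

text \<open>Without parallel arcs \<open>head G\<close> is injective on outgoing arcs. This ties
  averages over neighbours to degrees.\<close>

lemma card_neighbours: "card (N x) = out_degree G x"
proof -
  have "N x = head G ` out_arcs G x"
    by (auto simp: neighbours_def out_arcs_def arcs_ends_def arc_to_ends_def)
  moreover have "inj_on (head G) (out_arcs G x)"
    by (auto simp: inj_on_def out_arcs_def intro: no_multi_arcs simp: arc_to_ends_def)
  ultimately show ?thesis by (simp add: out_degree_def card_image)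
qed

lemma neighbour_arc:
  assumes "u \<in> N x"
  obtains a where "a \<in> arcs G" "tail G a = x" "head G a = u"
  using assms by (auto simp: neighbours_def arcs_ends_def arc_to_ends_def)

text \<open>Each arc is replaced by its opposite. The visited vertices are tracked because reversed
  walks must later be known to avoid a given vertex.\<close>

lemma awalk_rev:
  assumes "awalk u p v"
  shows "\<exists>q. awalk v q u \<and> length q = length p \<and> set (awalk_verts v q) = set (awalk_verts u p)"
  using assms
proof (induction p arbitrary: u)
  case Nil
  then show ?case by (auto simp: awalk_Nil_iff)
next
  case (Cons a p)
  then have a: "a \<in> arcs G" "tail G a = u" and p: "awalk (head G a) p v"
    by (auto simp: awalk_Cons_iff)
  from Cons.IH[OF p] obtain q where q: "awalk v q (head G a)" "length q = length p"
    "set (awalk_verts v q) = set (awalk_verts (head G a) p)" by blast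
  have "head G a \<in> N u" using a by (auto simp: neighbours_def arcs_ends_def arc_to_ends_def)
  then have "u \<in> N (head G a)" using neighbours_sym by blast
  then obtain b where b: "b \<in> arcs G" "tail G b = head G a" "head G b = u"
    by (rule neighbour_arc)
  have "awalk (head G a) [b] u" using arc_implies_awalk[OF b(1)] b by simp
  then have w: "awalk v (q @ [b]) u" using q(1) by (rule awalk_appendI[rotated])
  have "head G a \<in> set (awalk_verts v q)" using q(3) set_awalk_verts[OF p] by simp
  then have "set (awalk_verts v (q @ [b])) = set (awalk_verts v q) \<union> {u}"
    using b set_awalk_verts_append[OF q(1) \<open>awalk (head G a) [b] u\<close>] by auto
  with w q a show ?case by (intro exI[of _ "q @ [b]"]) auto
qed

lemma awalk_exists:
  assumes "u \<in> V" "v \<in> V" shows "\<exists>p. awalk u p v"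
proof -
  have "u \<rightarrow>\<^sup>*\<^bsub>with_proj (mk_symmetric G)\<^esub> v"
    using conn assms by (auto simp: connected_def strongly_connected_def)
  then have "u \<rightarrow>\<^sup>*\<^bsub>G\<^esub> v"
    using reachable_mk_symmetric_eq sym_arcs by blast
  then show ?thesis by (simp add: reachable_awalk)
qed

lemma hops_awalk:
  assumes "u \<in> V" "v \<in> V" obtains p where "awalk u p v" "length p = hops u v"
proof -
  have "\<exists>p. awalk u p v \<and> length p = hops u v"
    unfolding hops_def by (rule LeastI_ex) (use awalk_exists[OF assms] in blast)
  with that show thesis by blast
qed

lemma hops_le: "awalk u p v \<Longrightarrow> hops u v \<le> length p"
  unfolding hops_def by (rule Least_le) blast

lemma graph_dist_eq_hops:
  assumes "u \<in> V" "v \<in> V" shows "graph_dist G u v = ereal (hops u v)"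
proof -
  have cost: "awalk_cost (\<lambda>_. 1) p = length p" for p :: "'b list"
    by (induction p) auto
  obtain p where p: "awalk u p v" "length p = hops u v" using assms by (rule hops_awalk)
  show ?thesis
    unfolding graph_dist_def \<mu>_def cost
    by (intro antisym INF_greatest INF_lower2[of p]) (auto simp: p hops_le)
qed

lemma hops_self: "u \<in> V \<Longrightarrow> hops u u = 0"
  using hops_le[of u "[]" u] by (simp add: awalk_Nil_iff)

lemma hops_eq_0D: "u \<in> V \<Longrightarrow> v \<in> V \<Longrightarrow> hops u v = 0 \<Longrightarrow> u = v"
  by (metis hops_awalk length_0_conv awalk_Nil_iff)

lemma hops_sym:
  assumes "u \<in> V" "v \<in> V" shows "hops u v = hops v u"
proof -
  have "hops v u \<le> hops u v" if "u \<in> V" "v \<in> V" for u v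
    using that by (metis hops_awalk awalk_rev hops_le)
  with assms show ?thesis by (simp add: le_antisym)
qed

lemma hops_triangle:
  assumes "u \<in> V" "v \<in> V" "w \<in> V" shows "hops u w \<le> hops u v + hops v w"
proof -
  obtain p q where "awalk u p v" "length p = hops u v" "awalk v q w" "length q = hops v w"
    using assms by (metis hops_awalk)
  then show ?thesis using hops_le[OF awalk_appendI[of u p v q w]] by simp
qed

lemma hops_neighbour_le:
  assumes "u \<in> N x" "x \<in> V" "z \<in> V" shows "hops u z \<le> Suc (hops x z)"
proof -
  obtain a where a: "a \<in> arcs G" "tail G a = u" "head G a = x"
    using assms neighbours_sym by (metis neighbour_arc)
  obtain p where p: "awalk x p z" "length p = hops x z" using assms by (metis hops_awalk)
  have "awalk u (a # p) z" using a p by (auto simp: awalk_Cons_iff)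
  from hops_le[OF this] p show ?thesis by simp
qed

section \<open>Uniqueness of the closer neighbour\<close>

text \<open>Deleting \<open>x\<close> separates its neighbours: two distinct ones joined by a walk
  avoiding \<open>x\<close> would close up through \<open>x\<close> to a cycle.\<close>

lemma neighbour_eq_of_awalk_avoiding:
  assumes "u1 \<in> N x" "u2 \<in> N x" "awalk u1 p u2" "x \<notin> set (awalk_verts u1 p)"
  shows "u1 = u2"
proof (rule ccontr)
  assume "u1 \<noteq> u2"
  \<comment> \<open>Shortcutting to a path makes the vertices distinct, as \<open>cycle\<close>
    demands.\<close>
  define q where "q = awalk_to_apath p"
  have q: "apath u1 q u2" unfolding q_def using assms(3) by (rule apath_awalk_to_apath)
  then have qw: "awalk u1 q u2" and qd: "distinct (awalk_verts u1 q)" by (auto simp: apath_def)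
  have "set (awalk_verts u1 q) \<subseteq> set (awalk_verts u1 p)"
    using awalk_to_apath_subset[OF assms(3)] set_awalk_verts[OF assms(3)] set_awalk_verts[OF qw]
    unfolding q_def by auto
  with assms(4) have xq: "x \<notin> set (awalk_verts u1 q)" by blast
  obtain a where a: "a \<in> arcs G" "tail G a = x" "head G a = u1" using assms(1) by (rule neighbour_arc)
  obtain b where b: "b \<in> arcs G" "tail G b = u2" "head G b = x"
    using assms(2) neighbours_sym by (metis neighbour_arc)
  have bw: "awalk u2 [b] x" using arc_implies_awalk[OF b(1)] b by simp
  have qb: "awalk u1 (q @ [b]) x" using qw bw by (rule awalk_appendI)
  have cw: "awalk x (a # q @ [b]) x" using a qb by (auto simp: awalk_Cons_iff)
  have "awalk_verts u1 (q @ [b]) = awalk_verts u1 q @ [x]"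
    using awalk_verts_append[OF qb] b qw by simp
  then have "distinct (tl (awalk_verts x (a # q @ [b])))"
    using a qd xq by simp
  with cw have "cycle (a # q @ [b])" unfolding cycle_def by blast
  \<comment> \<open>A nonempty \<open>q\<close> gives the closed walk at least three arcs, so it is
    not a mere back-and-forth along one edge.\<close>
  moreover have "q \<noteq> []" using qw \<open>u1 \<noteq> u2\<close> by (auto simp: awalk_Nil_iff)
  ultimately show False using acyclic[of "a # q @ [b]"] by (cases q) auto
qed

text \<open>If the walk met \<open>x\<close>, at least one arc would precede that visit, and the
  rest would be a walk from \<open>x\<close> to \<open>z\<close> shorter than
  \<open>hops x z\<close>.\<close>

lemma shortest_awalk_avoids:
  assumes "awalk u p z" "length p = hops u z" "hops u z \<le> hops x z" "u \<noteq> x"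
  shows "x \<notin> set (awalk_verts u p)"
proof
  assume "x \<in> set (awalk_verts u p)"
  then obtain q r where *: "p = q @ r" "awalk u q x" "awalk x r z"
    using awalk_decomp[OF assms(1)] by blast
  have "q \<noteq> []" using * assms(4) by (auto simp: awalk_Nil_iff)
  then show False using * assms hops_le[of x r z] by (cases q) auto
qed

text \<open>Shortest walks from both neighbours to \<open>z\<close> avoid \<open>x\<close>; joined
  at \<open>z\<close> they connect the neighbours without \<open>x\<close>. The weak inequality
  matters: once a strictly closer neighbour exists, it excludes neighbours at the same distance as
  \<open>x\<close>.\<close>

lemma closer_neighbour_unique:
  assumes "u1 \<in> N x" "u2 \<in> N x" "z \<in> V"
    and "hops u1 z \<le> hops x z" "hops u2 z \<le> hops x z"
  shows "u1 = u2"
proof -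
  have ne: "u1 \<noteq> x" "u2 \<noteq> x" using assms(1,2) adj_not_same by (auto simp: neighbours_def)
  have V: "u1 \<in> V" "u2 \<in> V" using assms(1,2) neighbours_subset by auto
  obtain p1 where p1: "awalk u1 p1 z" "length p1 = hops u1 z" using V(1) assms(3) by (rule hops_awalk)
  obtain p2 where p2: "awalk u2 p2 z" "length p2 = hops u2 z" using V(2) assms(3) by (rule hops_awalk)
  obtain q where q: "awalk z q u2" "set (awalk_verts z q) = set (awalk_verts u2 p2)"
    using awalk_rev[OF p2(1)] by blast
  have "x \<notin> set (awalk_verts u1 p1)" "x \<notin> set (awalk_verts z q)"
    using shortest_awalk_avoids p1 p2 assms q ne by auto
  then have "x \<notin> set (awalk_verts u1 (p1 @ q))"
    using set_awalk_verts_append[OF p1(1) q(1)] by simp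
  with assms(1,2) awalk_appendI[OF p1(1) q(1)] show ?thesis
    by (rule neighbour_eq_of_awalk_avoiding[rotated 3, rotated 1])
qed

lemma closer_neighbour_exists:
  assumes "x \<in> V" "z \<in> V" "x \<noteq> z"
  shows "\<exists>u\<in>N x. Suc (hops u z) = hops x z"
proof -
  obtain p where p: "awalk x p z" "length p = hops x z" using assms by (metis hops_awalk)
  then obtain a r where r: "p = a # r" using assms(3) by (cases p) (auto simp: awalk_Nil_iff)
  with p have a: "a \<in> arcs G" "tail G a = x" "awalk (head G a) r z" by (auto simp: awalk_Cons_iff)
  have u: "head G a \<in> N x" using a by (auto simp: neighbours_def arcs_ends_def arc_to_ends_def)
  have "hops (head G a) z \<le> length r" using a(3) by (rule hops_le)
  moreover have "hops x z \<le> Suc (hops (head G a) z)"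
    using u assms neighbours_sym neighbours_subset by (intro hops_neighbour_le) auto
  ultimately show ?thesis using u p r by (intro bexI[of _ "head G a"]) auto
qed

section \<open>The Laplacian of the distance and sums over arcs\<close>

text \<open>The product is the value if all neighbours were one farther from \<open>z\<close>; the 2
  corrects for the unique closer one, which is missing at \<open>x = z\<close>.\<close>

lemma hops_laplacian:
  assumes "x \<in> V" "z \<in> V"
  shows "(\<Sum>u\<in>N x. real (hops u z)) = real (out_degree G x) * (real (hops x z) + 1) - (if x = z then 0 else 2)"
proof (cases "x = z")
  case True
  have "hops u z = 1" if "u \<in> N x" for u
  proof -
    have "u \<noteq> z" using that True adj_not_same by (auto simp: neighbours_def)
    then have "hops u z \<noteq> 0" using that assms neighbours_subset hops_eq_0D by blast
    moreover have "hops u z \<le> 1" using hops_neighbour_le[OF that assms] True assms hops_self by simp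
    ultimately show ?thesis by simp
  qed
  then show ?thesis using True assms by (simp add: hops_self card_neighbours)
next
  case False
  then obtain c where c: "c \<in> N x" "Suc (hops c z) = hops x z"
    using assms closer_neighbour_exists by blast
  have far: "hops u z = hops x z + 1" if "u \<in> N x - {c}" for u
  proof -
    have "\<not> hops u z \<le> hops x z" using closer_neighbour_unique[of u x c z] that c assms by auto
    with hops_neighbour_le[of u x z] that assms show ?thesis by simp
  qed
  have "(\<Sum>u\<in>N x. real (hops u z)) = real (hops c z) + (\<Sum>u\<in>N x - {c}. real (hops u z))"
    using c finite_neighbours by (simp add: sum.remove)
  moreover have "(\<Sum>u\<in>N x - {c}. real (hops u z)) = (real (out_degree G x) - 1) * (real (hops x z) + 1)"
  proof -
    have "real (card (N x - {c})) = real (out_degree G x) - 1"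
      using c(1) finite_neighbours[of x] card_gt_0_iff[of "N x"]
      by (auto simp: card_neighbours[symmetric] of_nat_diff Suc_le_eq)
    then show ?thesis using far by simp
  qed
  moreover have "real (hops x z) = real (hops c z) + 1" using c(2) by linarith
  ultimately show ?thesis using False by (simp add: algebra_simps)
qed

text \<open>Reversing all arcs permutes them, so a sum over arcs may be read at either
  endpoint.\<close>

lemma sum_neighbours_swap:
  fixes g :: "'a \<Rightarrow> 'a \<Rightarrow> real"
  shows "(\<Sum>w\<in>V. \<Sum>u\<in>N w. g w u) = (\<Sum>w\<in>V. \<Sum>u\<in>N w. g u w)"
proof -
  have N: "{u \<in> V. u \<in> N w} = N w" "{u \<in> V. w \<in> N u} = N w" for w
    using neighbours_subset neighbours_sym by blast+
  show ?thesis
    using sum.swap_restrict[OF finite_V finite_V, of g "\<lambda>w u. u \<in> N w"] by (simp add: N)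
qed

definition total_hops :: "'a \<Rightarrow> real" where "total_hops v = (\<Sum>w\<in>V. real (hops v w))"
text \<open>The number of edges of a tree, as a real so that subtraction does not truncate.\<close>

definition edge_count :: real where "edge_count = real (card V) - 1"

text \<open>The distance to a fixed \<open>z\<close>, summed over arcs at either endpoint, gives the
  same total. The distance terms cancel and leave the degree sum equal to
  \<open>2 * card V - 2\<close>.\<close>

lemma sum_out_degree:
  assumes "V \<noteq> {}" shows "(\<Sum>w\<in>V. real (out_degree G w)) = 2 * edge_count"
proof -
  obtain z where z: "z \<in> V" using assms by auto
  have "(\<Sum>w\<in>V. \<Sum>u\<in>N w. real (hops w z)) = (\<Sum>w\<in>V. \<Sum>u\<in>N w. real (hops u z))"
    by (rule sum_neighbours_swap)
  also have "\<dots> = (\<Sum>w\<in>V. out_degree G w * real (hops w z) + out_degree G w - 2 + (if w = z then 2 else 0))"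
    using z by (intro sum.cong refl) (simp add: hops_laplacian algebra_simps)
  also have "\<dots> = (\<Sum>w\<in>V. out_degree G w * real (hops w z)) + (\<Sum>w\<in>V. real (out_degree G w)) - 2 * card V + 2"
    using z by (simp add: sum.distrib sum_subtractf)
  finally show ?thesis by (simp add: card_neighbours edge_count_def)
qed

text \<open>Arc reversal is applied to squared distances to \<open>v\<close>. Distances at adjacent
  vertices differ by exactly 1, so the square at \<open>u\<close> is affine in the distance of
  \<open>u\<close>, and \<open>hops_laplacian\<close> evaluates its sum over neighbours.\<close>

lemma weighted_hops_sum:
  assumes v: "v \<in> V"
  shows "(\<Sum>w\<in>V. out_degree G w * real (hops v w)) = 2 * total_hops v - edge_count"
proof -
  let ?f = "\<lambda>w. real (hops w v)" and ?d = "\<lambda>w. real (out_degree G w)"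
  have sq: "(?f u)^2 = 2 * ?f w * ?f u - (?f w)^2 + 1" if wu: "w \<in> V" "u \<in> N w" for u w
  proof -
    have "hops u v \<le> hops w v + 1" "hops w v \<le> hops u v + 1"
      using hops_neighbour_le[of u w v] hops_neighbour_le[of w u v] that v neighbours_sym[of u w] neighbours_subset by auto
    moreover have "hops u v \<noteq> hops w v"
    \<comment> \<open>With equal distances, \<open>u\<close> and the strictly closer neighbour
      \<open>c\<close> of \<open>w\<close> would have to coincide.\<close>
    proof
      assume eq: "hops u v = hops w v"
      have "w \<noteq> v"
        using eq that v hops_self[OF v] hops_eq_0D[of u v] neighbours_subset[of w] adj_not_same
        by (auto simp: neighbours_def)
      then obtain c where "c \<in> N w" "Suc (hops c v) = hops w v"
        using closer_neighbour_exists[of w v] wu v by blast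
      with closer_neighbour_unique[of u w c v] eq wu v show False by auto
    qed
    ultimately have "(?f u - ?f w)^2 = 1" by (cases "hops u v \<le> hops w v") (auto simp: power2_eq_1_iff)
    then show ?thesis by (simp add: power2_eq_square algebra_simps)
  qed
  have "(\<Sum>w\<in>V. \<Sum>u\<in>N w. (?f w)^2) = (\<Sum>w\<in>V. \<Sum>u\<in>N w. (?f u)^2)"
    by (rule sum_neighbours_swap)
  also have "\<dots> = (\<Sum>w\<in>V. ?d w * (?f w)^2 + 2 * (?d w * ?f w) - 4 * ?f w + ?d w)"
  proof (intro sum.cong refl)
    fix w assume w: "w \<in> V"
    have "(\<Sum>u\<in>N w. (?f u)^2) = 2 * ?f w * (\<Sum>u\<in>N w. ?f u) - ?d w * (?f w)^2 + ?d w"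
      using sq[OF w] by (simp add: sum.distrib sum_subtractf sum_distrib_left card_neighbours)
    \<comment> \<open>At \<open>w = v\<close> the Laplacian lacks its correction by 2, but there it
      is multiplied by distance 0.\<close>
    then show "(\<Sum>u\<in>N w. (?f u)^2) = ?d w * (?f w)^2 + 2 * (?d w * ?f w) - 4 * ?f w + ?d w"
      using w v by (cases "w = v") (simp_all add: hops_laplacian hops_self power2_eq_square algebra_simps)
  qed
  also have "\<dots> = (\<Sum>w\<in>V. ?d w * (?f w)^2) + 2 * (\<Sum>w\<in>V. ?d w * ?f w) - 4 * (\<Sum>w\<in>V. ?f w) + 2 * edge_count"
    using v by (subst sum_out_degree[symmetric]) (auto simp: sum.distrib sum_subtractf sum_distrib_left)
  finally have "(\<Sum>w\<in>V. ?d w * ?f w) = 2 * (\<Sum>w\<in>V. ?f w) - edge_count"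
    by (simp add: card_neighbours)
  then show ?thesis using v by (simp add: total_hops_def hops_sym cong: sum.cong)
qed

section \<open>The solution of the first-step equations\<close>

definition hit :: "'a \<Rightarrow> 'a \<Rightarrow> real" where
  "hit u v = edge_count * hops u v + total_hops v - total_hops u"

text \<open>The triangle inequality through \<open>v\<close>, summed over the
  \<open>edge_count\<close> many targets other than \<open>u\<close>. Nonnegativity lets
  \<open>ennreal\<close> represent \<open>hit\<close> without truncation.\<close>

lemma hit_nonneg:
  assumes "u \<in> V" "v \<in> V" shows "0 \<le> hit u v"
proof -
  have "total_hops u = (\<Sum>z\<in>V - {u}. real (hops u z))"
    using assms finite_V by (simp add: total_hops_def sum.remove hops_self)
  also have "\<dots> \<le> (\<Sum>z\<in>V - {u}. real (hops u v) + real (hops v z))"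
    using hops_triangle[of u v] assms by (intro sum_mono) (auto simp flip: of_nat_add)
  also have "\<dots> = edge_count * hops u v + (\<Sum>z\<in>V - {u}. real (hops v z))"
    using assms card_gt_0_iff[of V] by (auto simp: sum.distrib edge_count_def of_nat_diff Suc_le_eq)
  also have "\<dots> \<le> edge_count * hops u v + total_hops v"
    unfolding total_hops_def using finite_V by (intro add_left_mono sum_mono2) auto
  finally show ?thesis by (simp add: hit_def)
qed

text \<open>The Laplacian identity summed over all targets \<open>z\<close>: every target except
  \<open>x\<close> contributes a correction of 2.\<close>

lemma sum_neighbours_total_hops:
  assumes "x \<in> V"
  shows "(\<Sum>u\<in>N x. total_hops u) = out_degree G x * total_hops x + out_degree G x * card V - 2 * edge_count"
proof -
  have "(\<Sum>u\<in>N x. total_hops u) = (\<Sum>z\<in>V. \<Sum>u\<in>N x. real (hops u z))"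
    unfolding total_hops_def by (rule sum.swap)
  also have "\<dots> = (\<Sum>z\<in>V. out_degree G x * real (hops x z) + out_degree G x - 2 + (if x = z then 2 else 0))"
    using assms by (intro sum.cong refl) (simp add: hops_laplacian algebra_simps)
  also have "\<dots> = out_degree G x * total_hops x + out_degree G x * card V - 2 * edge_count"
    using assms by (simp add: sum.distrib sum_subtractf total_hops_def sum_distrib_left edge_count_def)
  finally show ?thesis .
qed

lemma hit_step:
  assumes "u \<in> V" "v \<in> V" "u \<noteq> v"
  shows "hit u v = 1 + (\<Sum>z\<in>N u. hit z v) / card (N u)"
proof -
  have pos: "0 < card (N u)"
    using closer_neighbour_exists[OF assms] finite_neighbours[of u] by (auto simp: card_gt_0_iff)
  have "(\<Sum>z\<in>N u. hit z v) = edge_count * (\<Sum>z\<in>N u. real (hops z v)) + card (N u) * total_hops v - (\<Sum>z\<in>N u. total_hops z)"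
    by (simp add: hit_def sum.distrib sum_subtractf sum_distrib_left)
  \<comment> \<open>The Laplacians combine to
    \<open>edge_count * (d - 2) - (d * card V - 2 * edge_count) = - d\<close> with \<open>d\<close>
    the degree of \<open>u\<close>, because \<open>card V = edge_count + 1\<close>.\<close>
  also have "\<dots> = card (N u) * (hit u v - 1)"
    using assms by (simp add: hops_laplacian sum_neighbours_total_hops card_neighbours hit_def edge_count_def algebra_simps)
  finally show ?thesis using pos by simp
qed

lemma H_eq_hit:
  assumes "u \<in> V" "v \<in> V" shows "H G u v = ennreal (hit u v)"
proof (rule hitting_time_expectation[where V = V])
  fix x assume x: "x \<in> V" "x \<noteq> v"
  show "neighbours G x \<subseteq> V \<and> neighbours G x \<noteq> {}"
    using closer_neighbour_exists[of x v] neighbours_subset x assms by blast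
  show "hit x v = 1 + (\<Sum>z\<in>neighbours G x. hit z v) / card (neighbours G x)"
    using x assms by (intro hit_step) auto
qed (use assms in \<open>auto simp: hit_nonneg\<close>, simp add: hit_def hops_self)

section \<open>Closed forms of the vertex sums\<close>

lemma D_eq:
  assumes "v \<in> V" shows "D G v = ereal (total_hops v)"
  using assms by (simp add: D_def total_hops_def graph_dist_eq_hops)

lemma D_pi_eq:
  assumes "v \<in> V" shows "D_pi G v = ereal (2 * total_hops v - edge_count)"
  using assms by (simp add: D_pi_def graph_dist_eq_hops flip: weighted_hops_sum)

lemma CC_eq: "v \<in> V \<Longrightarrow> CC G v = ennreal (\<Sum>w\<in>V. hit v w)"
  by (simp add: CC_def H_eq_hit hit_nonneg sum_ennreal)

lemma RC_eq: "v \<in> V \<Longrightarrow> RC G v = ennreal (\<Sum>w\<in>V. hit w v)"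
  by (simp add: RC_def H_eq_hit hit_nonneg sum_ennreal)

lemma RC_pi_eq:
  assumes "v \<in> V" shows "RC_pi G v = ennreal (\<Sum>w\<in>V. real (out_degree G w) * hit w v)"
proof -
  have "RC_pi G v = (\<Sum>w\<in>V. ennreal (real (out_degree G w) * hit w v))"
    unfolding RC_pi_def using assms
    by (intro sum.cong refl) (simp add: H_eq_hit hit_nonneg ennreal_mult ennreal_of_nat_eq_real_of_nat)
  also have "\<dots> = ennreal (\<Sum>w\<in>V. real (out_degree G w) * hit w v)"
    using assms by (intro sum_ennreal) (simp add: hit_nonneg)
  finally show ?thesis .
qed

text \<open>The sign reversal for \<open>CC\<close> arises here: \<open>total_hops v\<close> is
  added \<open>edge_count\<close> times but subtracted \<open>card V\<close> times, one
  more.\<close>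

lemma sum_hit_from: "(\<Sum>w\<in>V. hit v w) = (\<Sum>w\<in>V. total_hops w) - total_hops v"
proof -
  have "(\<Sum>w\<in>V. hit v w) = edge_count * total_hops v + (\<Sum>w\<in>V. total_hops w) - card V * total_hops v"
    by (simp add: hit_def sum.distrib sum_subtractf total_hops_def[of v] sum_distrib_left)
  then show ?thesis by (simp add: edge_count_def algebra_simps)
qed

lemma sum_hit_to:
  assumes "v \<in> V"
  shows "(\<Sum>w\<in>V. hit w v) = (edge_count + card V) * total_hops v - (\<Sum>w\<in>V. total_hops w)"
proof -
  have "(\<Sum>w\<in>V. real (hops w v)) = total_hops v"
    unfolding total_hops_def using assms by (intro sum.cong refl) (simp add: hops_sym)
  then have "(\<Sum>w\<in>V. hit w v) = edge_count * total_hops v + card V * total_hops v - (\<Sum>w\<in>V. total_hops w)"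
    by (simp add: hit_def sum.distrib sum_subtractf flip: sum_distrib_left)
  then show ?thesis by (simp add: algebra_simps)
qed

text \<open>The slope 4 collects two equal contributions: one from \<open>weighted_hops_sum\<close>,
  one from the degree sum.\<close>

lemma weighted_sum_hit_to:
  assumes "v \<in> V"
  shows "(\<Sum>w\<in>V. real (out_degree G w) * hit w v)
       = 4 * edge_count * total_hops v - edge_count * edge_count - (\<Sum>w\<in>V. real (out_degree G w) * total_hops w)"
proof -
  have "(\<Sum>w\<in>V. real (out_degree G w) * hit w v)
      = (\<Sum>w\<in>V. edge_count * (real (out_degree G w) * real (hops v w)) + total_hops v * real (out_degree G w)
          - real (out_degree G w) * total_hops w)"
  proof (intro sum.cong refl)
    fix w assume "w \<in> V"
    then have "hops w v = hops v w" using assms by (intro hops_sym)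
    then show "real (out_degree G w) * hit w v = edge_count * (real (out_degree G w) * real (hops v w))
        + total_hops v * real (out_degree G w) - real (out_degree G w) * total_hops w"
      by (simp add: hit_def algebra_simps)
  qed
  also have "\<dots> = edge_count * (\<Sum>w\<in>V. real (out_degree G w) * real (hops v w))
      + total_hops v * (\<Sum>w\<in>V. real (out_degree G w)) - (\<Sum>w\<in>V. real (out_degree G w) * total_hops w)"
    by (simp add: sum.distrib sum_subtractf sum_distrib_left)
  also have "\<dots> = edge_count * (2 * total_hops v - edge_count) + total_hops v * (2 * edge_count) - (\<Sum>w\<in>V. real (out_degree G w) * total_hops w)"
    using assms weighted_hops_sum[of v] sum_out_degree by auto
  finally show ?thesis by (simp add: algebra_simps)
qed

end

section \<open>Comparison of the six quantities\<close>

theorem theorem3: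
  fixes T :: "('a, 'b) pre_digraph" and x y :: 'a
  assumes "undirected_tree T" and "x \<in> verts T" and "y \<in> verts T"
  shows "(D T x \<le> D T y \<longleftrightarrow> D_pi T x \<le> D_pi T y)
       \<and> (D T x \<le> D T y \<longleftrightarrow> H T y x \<le> H T x y)
       \<and> (D T x \<le> D T y \<longleftrightarrow> RC_pi T x \<le> RC_pi T y)
       \<and> (D T x \<le> D T y \<longleftrightarrow> RC T x \<le> RC T y)
       \<and> (D T x \<le> D T y \<longleftrightarrow> CC T x \<ge> CC T y)"
\<comment> \<open>Distinct vertices make \<open>edge_count\<close> positive, hence the slopes of
  \<open>RC\<close> and \<open>RC_pi\<close> too; for equal vertices every comparison is
  reflexive.\<close>
proof (cases "x = y")
  case False
  interpret acyclic_connected_graph T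
    using assms(1) by (auto simp: undirected_tree_def acyclic_connected_graph_def
        acyclic_connected_graph_axioms_def not_le[symmetric])
  note V = assms(2,3)
  have "card {x, y} \<le> card V" using V by (intro card_mono) auto
  with False have pos: "0 < edge_count" by (simp add: edge_count_def)
  have "H T y x \<le> H T x y \<longleftrightarrow> hit y x \<le> hit x y"
    using V by (simp add: H_eq_hit ennreal_le_iff hit_nonneg)
  \<comment> \<open>By symmetry the distance terms cancel, leaving twice the difference of
    \<open>total_hops\<close>.\<close>
  also have "\<dots> \<longleftrightarrow> total_hops x \<le> total_hops y"
    using V by (auto simp: hit_def hops_sym[of y x])
  finally have H: "H T y x \<le> H T x y \<longleftrightarrow> total_hops x \<le> total_hops y" .
  have "RC T x \<le> RC T y \<longleftrightarrow> (\<Sum>w\<in>V. hit w x) \<le> (\<Sum>w\<in>V. hit w y)"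
    using V by (simp add: RC_eq ennreal_le_iff hit_nonneg sum_nonneg)
  also have "\<dots> \<longleftrightarrow> (edge_count + card V) * total_hops x \<le> (edge_count + card V) * total_hops y"
    using V by (simp add: sum_hit_to)
  also have "\<dots> \<longleftrightarrow> total_hops x \<le> total_hops y"
    using pos by (intro mult_le_cancel_left_pos) simp
  finally have RC: "RC T x \<le> RC T y \<longleftrightarrow> total_hops x \<le> total_hops y" .
  have "RC_pi T x \<le> RC_pi T y \<longleftrightarrow>
      (\<Sum>w\<in>V. real (out_degree T w) * hit w x) \<le> (\<Sum>w\<in>V. real (out_degree T w) * hit w y)"
    using V by (simp add: RC_pi_eq ennreal_le_iff hit_nonneg sum_nonneg)
  also have "\<dots> \<longleftrightarrow> total_hops x \<le> total_hops y"
    using V pos by (simp add: weighted_sum_hit_to)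
  finally have RC_pi: "RC_pi T x \<le> RC_pi T y \<longleftrightarrow> total_hops x \<le> total_hops y" .
  have "CC T y \<le> CC T x \<longleftrightarrow> (\<Sum>w\<in>V. hit y w) \<le> (\<Sum>w\<in>V. hit x w)"
    using V by (simp add: CC_eq ennreal_le_iff hit_nonneg sum_nonneg)
  also have "\<dots> \<longleftrightarrow> total_hops x \<le> total_hops y"
    by (simp add: sum_hit_from)
  finally have CC: "CC T y \<le> CC T x \<longleftrightarrow> total_hops x \<le> total_hops y" .
  show ?thesis
    using V unfolding H RC RC_pi CC by (simp add: D_eq D_pi_eq)
qed simp

end
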